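(* In the setting described in the context ($X,Y,Q,A,M,\alpha,\ell,K,F,L,C,\delta_{K,M},\omega$, and a fixed $\rho>0$), let $x^\dagger\in K$ and let $\{x_j\}_{j\in J}\subseteq K$ be a finite set of points satisfying $$K\subseteq\bigcup_{j\in J}B_X(x_j,r)\qquad\text{with}\qquad r=\frac{1}{L\|Q\|_{\mathcal{L}(Y,Y)}}\bigg(\frac{\min\{\omega^{-1}(\rho),\delta_{K,M}\}}{C}\bigg)^{1/\alpha}.$$ Then the inequality $$\|QF(x_0)-QF(x^\dagger)\|_Y<\bigg(\frac{\min\{\omega^{-1}(\rho),\delta_{K,M}\}}{C}\bigg)^{1/\alpha}$$ holds for at least one point $x_0=x_j$ in the set.
   Context: Setting. $X$ and $Y$ are Banach spaces; $Q\colon Y\to Y$ is a continuous finite-rank operator; $A\subseteq X$ is open; $M\subseteq A$ is an $n$-dimensional differentiable manifold with atlas $\{(U_i,\varphi_i)\}_{i\in I}$, i.e. $U_i\subseteq M$ are open in $M$ (topology inherited from $X$), $\bigcup_iU_i=M$, $\varphi_i\colon U_i\to\varphi_i(U_i)\subseteq\mathbb{R}^n$ are homeomorphisms onto open sets, and the transition maps are $C^1$. $M$ is $\alpha$-Hölder in $X$ for some $\alpha\in(\frac12,1]$ with constant $\ell\in(0,1]$: $|\varphi_i(x)-\varphi_i(y)|^\alpha\ge\ell\|x-y\|_X$ for all $i\in I$, $x,y\in U_i$. $K\subseteq M$ is compact. $F\in C^1(M,Y)$ (each $F\circ\varphi_i^{-1}$ is continuously Fréchet differentiable) is such that: $\|F(x)-F(y)\|_Y\le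 L\|x-y\|_X$ for $x,y\in K$, with $L>0$; $(F\circ\varphi_i^{-1})'\colon\varphi_i(U_i)\to\mathcal{L}(\mathbb{R}^n,Y)$ is Lipschitz for every $i$; and there is $C>0$ with $\|x-y\|_X\le C\|QF(x)-QF(y)\|_Y^\alpha$ for all $x,y\in M$. $\delta_{K,M}>0$ and compact sets $K_1,\dots,K_m\subseteq M$ are fixed with $K=K_1\cup\dots\cup K_m$ and such that for every $j$ there is $i_j\in I$ with $\overline{B_X(K_j,\delta_{K,M})}\cap M\subseteq U_{i_j}$, where $B_X(S,\delta)=\bigcup_{x\in S}B_X(x,\delta)$. $\omega$ is a common (non-decreasing) modulus of continuity of the maps $\varphi_{i_j}$ restricted to $\overline{B_X(K_j,\delta_{K,M})}\cap K$, $j=1,\dots,m$, and $\omega^{-1}(\rho)=\sup\{t>0:\omega(t)<\rho\}$. Here $Q\ne0$ (so that $r$ is defined). *)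

theory Defs
  imports "HOL-Analysis.Analysis"
begin

definition finite_rank :: "('a::real_normed_vector \<Rightarrow>\<^sub>L 'b::real_normed_vector) \<Rightarrow> bool" where
  "finite_rank T \<longleftrightarrow> (\<exists>B. finite B \<and> range (blinfun_apply T) \<subseteq> span B)"

text \<open>The derivative as an element of the space of bounded linear operators with the
  operator norm; meaningful at points of differentiability.\<close>

definition fderiv ::
  "('a::real_normed_vector \<Rightarrow> 'b::real_normed_vector) \<Rightarrow> 'a \<Rightarrow> ('a \<Rightarrow>\<^sub>L 'b)" where
  "fderiv f x = Blinfun (frechet_derivative f (at x))"

definition C1_on ::
  "'a::real_normed_vector set \<Rightarrow> ('a \<Rightarrow> 'b::real_normed_vector) \<Rightarrow> bool" where
  "C1_on S f \<longleftrightarrow> open S \<and> (\<forall>x\<in>S. f differentiable (at x)) \<and> continuous_on S (fderiv f)"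

definition chart_inv :: "('i \<Rightarrow> 'a set) \<Rightarrow> ('i \<Rightarrow> 'a \<Rightarrow> 'e) \<Rightarrow> 'i \<Rightarrow> 'e \<Rightarrow> 'a" where
  "chart_inv U \<phi> i = inv_into (U i) (\<phi> i)"

text \<open>The dimension of the manifold is the cardinality of the index type \<open>'n\<close>. The maps
  \<open>\<phi> i\<close> are total functions, of which only the restrictions to \<open>U i\<close> matter.\<close>

definition C1_manifold ::
  "'a::real_normed_vector set \<Rightarrow> 'i set \<Rightarrow> ('i \<Rightarrow> 'a set) \<Rightarrow> ('i \<Rightarrow> 'a \<Rightarrow> real ^ 'n) \<Rightarrow> bool" where
  "C1_manifold M I U \<phi> \<longleftrightarrow>
     (\<forall>i\<in>I. openin (top_of_set M) (U i)) \<and>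
     (\<Union>i\<in>I. U i) = M \<and>
     (\<forall>i\<in>I. open (\<phi> i ` U i) \<and> homeomorphism (U i) (\<phi> i ` U i) (\<phi> i) (chart_inv U \<phi> i)) \<and>
     (\<forall>i\<in>I. \<forall>j\<in>I. C1_on (\<phi> i ` (U i \<inter> U j)) (\<phi> j \<circ> chart_inv U \<phi> i))"

definition C1_on_manifold ::
  "'i set \<Rightarrow> ('i \<Rightarrow> 'a::real_normed_vector set) \<Rightarrow> ('i \<Rightarrow> 'a \<Rightarrow> real ^ 'n) \<Rightarrow>
     ('a \<Rightarrow> 'b::real_normed_vector) \<Rightarrow> bool" where
  "C1_on_manifold I U \<phi> F \<longleftrightarrow> (\<forall>i\<in>I. C1_on (\<phi> i ` U i) (F \<circ> chart_inv U \<phi> i))"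

definition Hoelder_atlas ::
  "'i set \<Rightarrow> ('i \<Rightarrow> 'a::real_normed_vector set) \<Rightarrow> ('i \<Rightarrow> 'a \<Rightarrow> real ^ 'n) \<Rightarrow>
     real \<Rightarrow> real \<Rightarrow> bool" where
  "Hoelder_atlas I U \<phi> \<alpha> l \<longleftrightarrow>
     (\<forall>i\<in>I. \<forall>x\<in>U i. \<forall>y\<in>U i. norm (\<phi> i x - \<phi> i y) powr \<alpha> \<ge> l * norm (x - y))"

definition nbhd :: "'a::metric_space set \<Rightarrow> real \<Rightarrow> 'a set" where
  "nbhd S \<delta> = (\<Union>x\<in>S. ball x \<delta>)"

text \<open>Only the values of a modulus on the half-line of nonnegative reals matter;
  \<open>\<omega> 0 = 0\<close> follows from the conditions below.\<close>

definition modulus :: "(real \<Rightarrow> real) \<Rightarrow> bool" where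
  "modulus \<omega> \<longleftrightarrow> (\<forall>t\<ge>0. 0 \<le> \<omega> t) \<and> mono_on {0..} \<omega> \<and> (\<omega> \<longlongrightarrow> 0) (at_right 0)"

definition modulus_of_continuity_on ::
  "(real \<Rightarrow> real) \<Rightarrow> 'a::metric_space set \<Rightarrow> ('a \<Rightarrow> 'b::metric_space) \<Rightarrow> bool" where
  "modulus_of_continuity_on \<omega> S f \<longleftrightarrow>
     modulus \<omega> \<and> (\<forall>x\<in>S. \<forall>y\<in>S. dist (f x) (f y) \<le> \<omega> (dist x y))"

text \<open>The supremum is infinite when \<open>\<omega>\<close> stays below \<open>\<rho>\<close>, hence the extended reals; the
  minimum with \<open>\<delta>\<close> is then \<open>\<delta>\<close>.\<close>

definition modulus_inv :: "(real \<Rightarrow> real) \<Rightarrow> real \<Rightarrow> ereal" where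
  "modulus_inv \<omega> \<rho> = Sup (ereal ` {t. 0 < t \<and> \<omega> t < \<rho>})"

definition min_modulus_inv :: "(real \<Rightarrow> real) \<Rightarrow> real \<Rightarrow> real \<Rightarrow> real" where
  "min_modulus_inv \<omega> \<rho> \<delta> = real_of_ereal (min (modulus_inv \<omega> \<rho>) (ereal \<delta>))"

end

theory Submission
  imports Defs
begin

text \<open>The radius \<open>r\<close> is the stability threshold divided by the Lipschitz constant
  \<open>L * norm Q\<close> of \<open>Q \<circ> F\<close> on \<open>K\<close>, so a net point within distance less than \<open>r\<close> of \<open>xdag\<close>
  has a measurement closer to that of \<open>xdag\<close> than the threshold. The inequality is strict because
  the balls of the net are open.\<close>

theorem lemma4p2:
  fixes Q :: "'b::banach \<Rightarrow>\<^sub>L 'b"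
    and A M K :: "'a::banach set"
    and I :: "'i set"
    and U :: "'i \<Rightarrow> 'a set"
    and \<phi> :: "'i \<Rightarrow> 'a \<Rightarrow> real ^ 'n"
    and F :: "'a \<Rightarrow> 'b"
    and \<alpha> l L C \<delta> \<rho> r :: real
    and m :: nat
    and Kc :: "nat \<Rightarrow> 'a set"
    and idx :: "nat \<Rightarrow> 'i"
    and \<omega> :: "real \<Rightarrow> real"
    and xdag :: 'a
    and J :: "'j set"
    and x :: "'j \<Rightarrow> 'a"
  assumes Q: "finite_rank Q" "Q \<noteq> 0"
    and A: "open A"
    and M: "M \<subseteq> A" "C1_manifold M I U \<phi>"
    and Hoelder: "1 / 2 < \<alpha>" "\<alpha> \<le> 1" "0 < l" "l \<le> 1" "Hoelder_atlas I U \<phi> \<alpha> l"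
    and K: "K \<subseteq> M" "compact K"
    and F_C1: "C1_on_manifold I U \<phi> F"
    and F_Lipschitz: "0 < L" "\<forall>y\<in>K. \<forall>z\<in>K. norm (F y - F z) \<le> L * norm (y - z)"
    and F_deriv_Lipschitz:
      "\<forall>i\<in>I. \<exists>\<Lambda>. \<Lambda>-lipschitz_on (\<phi> i ` U i) (fderiv (F \<circ> chart_inv U \<phi> i))"
    and QF_stable: "0 < C" "\<forall>y\<in>M. \<forall>z\<in>M. norm (y - z) \<le> C * norm (Q (F y) - Q (F z)) powr \<alpha>"
    and \<delta>: "0 < \<delta>"
    and cover: "\<forall>j\<in>{1..m}. compact (Kc j) \<and> Kc j \<subseteq> M" "K = (\<Union>j\<in>{1..m}. Kc j)"
      "\<forall>j\<in>{1..m}. idx j \<in> I \<and> closure (nbhd (Kc j) \<delta>) \<inter> M \<subseteq> U (idx j)"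
    and \<omega>: "\<forall>j\<in>{1..m}. modulus_of_continuity_on \<omega> (closure (nbhd (Kc j) \<delta>) \<inter> K) (\<phi> (idx j))"
    and \<rho>: "0 < \<rho>"
    and xdag: "xdag \<in> K"
    and points: "finite J" "\<forall>j\<in>J. x j \<in> K"
    and r: "r = 1 / (L * norm Q) * (min_modulus_inv \<omega> \<rho> \<delta> / C) powr (1 / \<alpha>)"
    and net: "K \<subseteq> (\<Union>j\<in>J. ball (x j) r)"
  shows "\<exists>j\<in>J. norm (Q (F (x j)) - Q (F xdag)) < (min_modulus_inv \<omega> \<rho> \<delta> / C) powr (1 / \<alpha>)"
proof -
  let ?R = "(min_modulus_inv \<omega> \<rho> \<delta> / C) powr (1 / \<alpha>)"
  have "0 < norm Q"
    using Q(2) by simp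
  then have "0 < norm Q * L"
    using F_Lipschitz(1) by simp
  from xdag net obtain j where j: "j \<in> J" "norm (x j - xdag) < r"
    by (auto simp: dist_norm)
  have "norm (Q (F (x j)) - Q (F xdag)) = norm (Q (F (x j) - F xdag))"
    by (simp add: blinfun.diff_right)
  also have "\<dots> \<le> norm Q * norm (F (x j) - F xdag)"
    by (rule norm_blinfun)
  also have "\<dots> \<le> norm Q * (L * norm (x j - xdag))"
    using F_Lipschitz(2) points(2) j(1) xdag by (intro mult_left_mono) auto
  also have "\<dots> < norm Q * L * r"
    using mult_strict_left_mono[OF j(2) \<open>0 < norm Q * L\<close>] by (simp add: mult.assoc)
  also have "\<dots> = ?R"
    unfolding r using Q(2) F_Lipschitz(1) by simp
  finally show ?thesis
    using j(1) by blast
qed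

end
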